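(* For every integer $n \geq 1$ and every partition $\lambda$ of $n$, the number of rectangles in the Young diagram of $\lambda$ is $$\sum_{u \in \lambda} h(u) + \frac{1}{2}\sum_{u \in \lambda} \tilde{h}(u)^2,$$ where the first term $\sum_{u \in \lambda} h(u)$ is the number of thin rectangles in $\lambda$ and the second term $\frac{1}{2}\sum_{u \in \lambda} \tilde{h}(u)^2$ is the number of thick rectangles in $\lambda$.
   Context: A partition $\lambda$ of $n$ is a weakly decreasing sequence of non-negative integers $\lambda_1 \geq \lambda_2 \geq \cdots$ with sum $n$, identified with its Young diagram: the set of cells $(i,j)$ with $i \ge 1$, $1 \le j \le \lambda_i$ ($i$ is the row, counted from the top, and $j$ the column). $\lambda'$ denotes the conjugate partition, so $\lambda'_j$ is the number of cells in column $j$ of $\lambda$. For a cell $u=(i,j) \in \lambda$, the hook $H(u)$ is the set of cells $(k,l) \in \lambda$ such that either $k=i$ and $l \geq j$, or $l=j$ and $k \geq i$, and the hook length is $h(u)=|H(u)| = \lambda_i + \lambda'_j - i - j + 1$. The partial hook length of $u=(i,j)$ is $$\tilde{h}(u) = \begin{cases} 0 & \text{if } i=j,\\ \lambda_i - j & \text{if } i>j,\\ \lambda'_j - i & \text{if } i<j.\end{cases}$$ A rectangle in $\lambda$ is a (nonempty) rectangle made up of cells of $\lambda$, i.e. a set $\{(a,b) : i_1 \le a \le i_2,\ j_1 \le b \le j_2\}$ with $1 \le i_1 \le i_2$, $1 \le j_1 \le j_2$, contained in the Young diagram of $\lambda$. It is thick if both its height and its width are greater than $1$, and thin otherwise. *)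

theory Defs
  imports Complex_Main
begin

text \<open>
  A partition is a sequence indexed by the positive integers, represented as a function on
  \<^typ>\<open>nat\<close>. The value at \<open>0\<close> is not part of the sequence: it is unconstrained, and nothing
  below depends on it.
\<close>

definition partition_of :: "nat \<Rightarrow> (nat \<Rightarrow> nat) \<Rightarrow> bool" where
  "partition_of n lam \<longleftrightarrow>
     (\<forall>i j. 1 \<le> i \<and> i \<le> j \<longrightarrow> lam j \<le> lam i) \<and>
     finite {i. 1 \<le> i \<and> lam i \<noteq> 0} \<and>
     (\<Sum>i \<in> {i. 1 \<le> i \<and> lam i \<noteq> 0}. lam i) = n"

definition young :: "(nat \<Rightarrow> nat) \<Rightarrow> (nat \<times> nat) set" where
  "young lam = {(i, j). 1 \<le> i \<and> 1 \<le> j \<and> j \<le> lam i}"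

definition conjugate :: "(nat \<Rightarrow> nat) \<Rightarrow> nat \<Rightarrow> nat" where
  "conjugate lam j = card {i. (i, j) \<in> young lam}"

definition hook :: "(nat \<Rightarrow> nat) \<Rightarrow> nat \<times> nat \<Rightarrow> (nat \<times> nat) set" where
  "hook lam = (\<lambda>(i, j). {(k, l) \<in> young lam. (k = i \<and> j \<le> l) \<or> (l = j \<and> i \<le> k)})"

definition hook_length :: "(nat \<Rightarrow> nat) \<Rightarrow> nat \<times> nat \<Rightarrow> nat" where
  "hook_length lam u = card (hook lam u)"

text \<open>Integer-valued, so that the subtractions are not truncated.\<close>

definition partial_hook_length :: "(nat \<Rightarrow> nat) \<Rightarrow> nat \<times> nat \<Rightarrow> int" where
  "partial_hook_length lam = (\<lambda>(i, j).
     if i = j then 0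
     else if i > j then int (lam i) - int j
     else int (conjugate lam j) - int i)"

definition rectangles :: "(nat \<Rightarrow> nat) \<Rightarrow> (nat \<times> nat) set set" where
  "rectangles lam = {R. R \<subseteq> young lam \<and>
     (\<exists>i1 i2 j1 j2. 1 \<le> i1 \<and> i1 \<le> i2 \<and> 1 \<le> j1 \<and> j1 \<le> j2 \<and> R = {i1..i2} \<times> {j1..j2})}"

text \<open>The height (width) of a rectangle is the number of rows (columns) that it meets.\<close>

definition thick :: "(nat \<times> nat) set \<Rightarrow> bool" where
  "thick R \<longleftrightarrow> card (fst ` R) > 1 \<and> card (snd ` R) > 1"

definition thick_rectangles :: "(nat \<Rightarrow> nat) \<Rightarrow> (nat \<times> nat) set set" where
  "thick_rectangles lam = {R \<in> rectangles lam. thick R}"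

definition thin_rectangles :: "(nat \<Rightarrow> nat) \<Rightarrow> (nat \<times> nat) set set" where
  "thin_rectangles lam = {R \<in> rectangles lam. \<not> thick R}"

end

theory Submission
  imports Defs
begin

text \<open>
  Every rectangle in the diagram is determined by its bottom-right cell \<open>(a, b)\<close> and its top-left
  cell, and since the diagram is closed under moving up and left, the only constraint is that
  \<open>(a, b)\<close> lies in the diagram. A cell \<open>(a, b)\<close> is therefore the bottom-right corner of \<open>a b\<close>
  rectangles, of which \<open>(a - 1) (b - 1)\<close> are thick and the other \<open>a + b - 1\<close> are thin.

  Thin rectangles: \<open>a + b - 1\<close> is also the number of cells whose hook contains \<open>(a, b)\<close>, so
  counting incidences between cells and hooks in two ways gives the sum of the hook lengths.

  Thick rectangles: a square is a sum of odd numbers,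
  \<open>(lam i - j)\<^sup>2 = (\<Sum>b\<in>{j<..lam i}. 2 (b - j) - 1)\<close>, so that the square of a partial hook length
  below the diagonal can be distributed over the cells \<open>(i, b)\<close> of its arm; above the diagonal the
  same is done with the cells \<open>(b, j)\<close> of the leg, which is the same statement for the conjugate
  partition (\<open>sum_squares_below_diagonal\<close>). In total a cell \<open>(a, b)\<close> receives
  \<open>\<Sum>j\<in>{1..<min a b}. (2 (b - j) - 1) + (2 (a - j) - 1)\<close>, which equals \<open>2 (a - 1) (b - 1)\<close>.
\<close>

section \<open>The diagram and its conjugate\<close>

lemma mem_young [simp]: "(i, j) \<in> young lam \<longleftrightarrow> 1 \<le> i \<and> 1 \<le> j \<and> j \<le> lam i"
  by (simp add: young_def)

lemma finite_young:
  assumes "partition_of n lam"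
  shows "finite (young lam)"
proof -
  have "young lam = Sigma {i. 1 \<le> i \<and> lam i \<noteq> 0} (\<lambda>i. {1..lam i})"
    by (auto simp: young_def)
  then show ?thesis
    using assms by (simp add: partition_of_def)
qed

lemma young_up_left:
  assumes "partition_of n lam" "(a, b) \<in> young lam" "1 \<le> i" "i \<le> a" "1 \<le> j" "j \<le> b"
  shows "(i, j) \<in> young lam"
proof -
  have "lam a \<le> lam i"
    using assms(1,3,4) unfolding partition_of_def by blast
  then show ?thesis
    using assms(2-) by simp
qed

text \<open>A column is an initial segment of the positive integers, hence equal to \<open>{1..m}\<close> with \<open>m\<close>
  its length; \<open>conjugate lam 0 = 0\<close> because column \<open>0\<close> is empty.\<close>

lemma young_conjugate:
  assumes "partition_of n lam"
  shows "young (conjugate lam) = prod.swap ` young lam"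
proof -
  have column: "i \<le> conjugate lam j \<longleftrightarrow> (i, j) \<in> young lam" if "1 \<le> i" for i j
  proof -
    let ?C = "{k. (k, j) \<in> young lam}"
    have "?C \<subseteq> fst ` young lam"
      by (fastforce intro: rev_image_eqI simp del: mem_young)
    then have fin: "finite ?C"
      using finite_young[OF assms] by (blast intro: finite_subset)
    show ?thesis
    proof
      assume "(i, j) \<in> young lam"
      then have "{1..i} \<subseteq> ?C"
        using young_up_left[OF assms, of i j] by auto
      from card_mono[OF fin this] show "i \<le> conjugate lam j"
        by (simp add: conjugate_def)
    next
      assume le: "i \<le> conjugate lam j"
      show "(i, j) \<in> young lam"
      proof (rule ccontr)
        assume out: "(i, j) \<notin> young lam"
        have "k < i" if k: "(k, j) \<in> young lam" for k
        proof (rule ccontr)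
          assume "\<not> k < i"
          then have "(i, j) \<in> young lam"
            using young_up_left[OF assms k \<open>1 \<le> i\<close>, of j] k by simp
          with out show False ..
        qed
        then have "?C \<subseteq> {1..<i}"
          by auto
        then have "card ?C \<le> i - 1"
          using card_mono[of "{1..<i}" ?C] by simp
        with le that show False
          by (simp add: conjugate_def)
      qed
    qed
  qed
  have "(j, i) \<in> young (conjugate lam) \<longleftrightarrow> (j, i) \<in> prod.swap ` young lam" for i j
    using column[of i j] by (auto simp: pair_in_swap_image)
  then show ?thesis
    by (intro set_eqI) (metis surj_pair)
qed

section \<open>Rectangles and their bottom-right cells\<close>

definition rectangle :: "(nat \<times> nat) \<times> (nat \<times> nat) \<Rightarrow> (nat \<times> nat) set" where
  "rectangle = (\<lambda>((a, b), (i, j)). {i..a} \<times> {j..b})"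

lemma thick_rectangle:
  assumes "i \<le> a" "j \<le> b"
  shows "thick (rectangle ((a, b), (i, j))) \<longleftrightarrow> i < a \<and> j < b"
  using assms by (auto simp: thick_def rectangle_def)

lemma inj_on_rectangle:
  "inj_on rectangle (Sigma Y (\<lambda>(a, b). {1..a} \<times> {1..b}))"
  by (auto simp: inj_on_def rectangle_def times_eq_iff Icc_eq_Icc)

lemma rectangles_eq:
  assumes "partition_of n lam"
  shows "rectangles lam = rectangle ` Sigma (young lam) (\<lambda>(a, b). {1..a} \<times> {1..b})"
proof (intro set_eqI iffI)
  fix R assume "R \<in> rectangles lam"
  then obtain i a j b where R: "R = {i..a} \<times> {j..b}" "R \<subseteq> young lam"
    and le: "1 \<le> i" "i \<le> a" "1 \<le> j" "j \<le> b"
    by (auto simp: rectangles_def)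
  then have "(a, b) \<in> young lam"
    by (meson SigmaI atLeastAtMost_iff order_refl subsetD)
  then have "((a, b), (i, j)) \<in> Sigma (young lam) (\<lambda>(a, b). {1..a} \<times> {1..b})"
    using le by simp
  moreover have "R = rectangle ((a, b), (i, j))"
    by (simp add: R rectangle_def)
  ultimately show "R \<in> rectangle ` Sigma (young lam) (\<lambda>(a, b). {1..a} \<times> {1..b})"
    by blast
next
  fix R assume "R \<in> rectangle ` Sigma (young lam) (\<lambda>(a, b). {1..a} \<times> {1..b})"
  then obtain a b i j where R: "R = {i..a} \<times> {j..b}" and ab: "(a, b) \<in> young lam"
    and le: "1 \<le> i" "i \<le> a" "1 \<le> j" "j \<le> b"
    by (auto simp: rectangle_def)
  have "R \<subseteq> young lam"
    using young_up_left[OF assms ab] le unfolding R by (auto simp del: mem_young)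
  with R le show "R \<in> rectangles lam"
    unfolding rectangles_def by blast
qed

lemma card_rectangles:
  assumes "partition_of n lam"
  shows "card (rectangles lam) = (\<Sum>(a, b) \<in> young lam. a * b)"
  unfolding rectangles_eq[OF assms] card_image[OF inj_on_rectangle]
  by (simp add: finite_young[OF assms] card_SigmaI case_prod_unfold)

lemma card_thick_rectangles:
  assumes "partition_of n lam"
  shows "card (thick_rectangles lam) = (\<Sum>(a, b) \<in> young lam. (a - 1) * (b - 1))"
proof -
  let ?S = "Sigma (young lam) (\<lambda>(a, b). {1..<a} \<times> {1..<b})"
  have "thick_rectangles lam =
      rectangle ` {p \<in> Sigma (young lam) (\<lambda>(a, b). {1..a} \<times> {1..b}). thick (rectangle p)}"
    by (auto simp: thick_rectangles_def rectangles_eq[OF assms])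
  also have "{p \<in> Sigma (young lam) (\<lambda>(a, b). {1..a} \<times> {1..b}). thick (rectangle p)} = ?S"
    by (auto simp: thick_rectangle)
  finally have "thick_rectangles lam = rectangle ` ?S" .
  moreover have "inj_on rectangle ?S"
    by (rule inj_on_subset[OF inj_on_rectangle[of "young lam"]]) auto
  ultimately show ?thesis
    by (simp add: card_image finite_young[OF assms] card_SigmaI case_prod_unfold)
qed

lemma card_thin_rectangles:
  assumes "partition_of n lam"
  shows "card (rectangles lam) = card (thin_rectangles lam) + card (thick_rectangles lam)"
    and "card (thin_rectangles lam) = (\<Sum>(a, b) \<in> young lam. a + b - 1)"
proof -
  have "finite (rectangles lam)"
    by (simp add: rectangles_eq[OF assms] finite_young[OF assms] case_prod_unfold)
  moreover have "rectangles lam = thin_rectangles lam \<union> thick_rectangles lam"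
    "thin_rectangles lam \<inter> thick_rectangles lam = {}"
    by (auto simp: thin_rectangles_def thick_rectangles_def)
  ultimately show split:
    "card (rectangles lam) = card (thin_rectangles lam) + card (thick_rectangles lam)"
    by (metis card_Un_disjoint finite_Un)
  have "a * b = (a + b - 1) + (a - 1) * (b - 1)" if "(a, b) \<in> young lam" for a b
    using that by (cases a; cases b) auto
  then have "(\<Sum>(a, b) \<in> young lam. a * b) =
      (\<Sum>(a, b) \<in> young lam. (a + b - 1) + (a - 1) * (b - 1))"
    by (intro sum.cong) auto
  also have "\<dots> = (\<Sum>(a, b) \<in> young lam. a + b - 1) + (\<Sum>(a, b) \<in> young lam. (a - 1) * (b - 1))"
    by (simp add: case_prod_unfold sum.distrib)
  finally show "card (thin_rectangles lam) = (\<Sum>(a, b) \<in> young lam. a + b - 1)"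
    using split by (simp add: card_rectangles[OF assms] card_thick_rectangles[OF assms])
qed

section \<open>Hook lengths\<close>

text \<open>Double counting of the pairs of a cell and a hook containing it: the corners of the hooks
  through \<open>(a, b)\<close> are the cells weakly to the left of it in its row and weakly above it in its
  column.\<close>

lemma sum_hook_length:
  assumes "partition_of n lam"
  shows "(\<Sum>u \<in> young lam. hook_length lam u) = (\<Sum>(a, b) \<in> young lam. a + b - 1)"
proof -
  let ?Y = "young lam"
  have "(\<Sum>u \<in> ?Y. hook_length lam u) = (\<Sum>u \<in> ?Y. \<Sum>v \<in> {v \<in> ?Y. v \<in> hook lam u}. 1)"
    unfolding hook_length_def card_eq_sum
    by (intro sum.cong) (auto simp: hook_def)
  also have "\<dots> = (\<Sum>v \<in> ?Y. \<Sum>u \<in> {u \<in> ?Y. v \<in> hook lam u}. 1)"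
    by (rule sum.swap_restrict) (use finite_young[OF assms] in auto)
  also have "\<dots> = (\<Sum>(a, b) \<in> ?Y. a + b - 1)"
  proof (intro sum.cong refl, clarify)
    fix a b assume ab: "(a, b) \<in> ?Y"
    have "{u \<in> ?Y. (a, b) \<in> hook lam u} = {a} \<times> {1..b} \<union> {1..<a} \<times> {b}"
      using ab young_up_left[OF assms ab] by (auto simp: hook_def)
    then have "card {u \<in> ?Y. (a, b) \<in> hook lam u} = card ({a} \<times> {1..b} \<union> {1..<a} \<times> {b})"
      by simp
    also have "\<dots> = b + (a - 1)"
      by (subst card_Un_disjoint) auto
    also have "\<dots> = a + b - 1"
      using ab by simp
    finally show "(\<Sum>u \<in> {u \<in> ?Y. (a, b) \<in> hook lam u}. 1) = a + b - 1"
      by simp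
  qed
  finally show ?thesis .
qed

section \<open>Partial hook lengths\<close>

lemma square_eq_sum_odd:
  assumes "j \<le> L"
  shows "(real L - real j)\<^sup>2 = (\<Sum>b\<in>{j<..L}. 2 * (real b - real j) - 1)"
  using assms
proof (induction L rule: dec_induct)
  case (step L)
  then have "{j<..Suc L} = insert (Suc L) {j<..L}"
    by auto
  with step.IH show ?case
    by (simp add: power2_eq_square algebra_simps)
qed simp

text \<open>Exchanging the order of summation moves the odd summand with index \<open>b\<close> from the cell
  \<open>(i, j)\<close> to the cell \<open>(i, b)\<close> to its right.\<close>

lemma sum_squares_below_diagonal:
  assumes fin: "finite (young lam)"
  shows "(\<Sum>(i, j) \<in> {(i, j) \<in> young lam. j < i}. (real (lam i) - real j)\<^sup>2) =
    (\<Sum>(i, b) \<in> young lam. \<Sum>j\<in>{1..<min i b}. 2 * (real b - real j) - 1)"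
proof -
  let ?L = "{(i, j) \<in> young lam. j < i}"
  have "finite ?L"
    by (rule finite_subset[OF _ fin]) auto
  have "(\<Sum>(i, j) \<in> ?L. (real (lam i) - real j)\<^sup>2) =
      (\<Sum>(i, j) \<in> ?L. \<Sum>b\<in>{j<..lam i}. 2 * (real b - real j) - 1)"
    by (intro sum.cong) (auto simp: square_eq_sum_odd)
  also have "\<dots> = (\<Sum>((i, j), b) \<in> Sigma ?L (\<lambda>(i, j). {j<..lam i}). 2 * (real b - real j) - 1)"
    using \<open>finite ?L\<close> by (subst sum.Sigma[symmetric]) (auto intro!: sum.cong)
  also have "\<dots> = (\<Sum>((i, b), j) \<in> Sigma (young lam) (\<lambda>(i, b). {1..<min i b}).
      2 * (real b - real j) - 1)"
    by (rule sum.reindex_bij_witness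
        [of _ "\<lambda>((i, b), j). ((i, j), b)" "\<lambda>((i, j), b). ((i, b), j)"]) auto
  also have "\<dots> = (\<Sum>(i, b) \<in> young lam. \<Sum>j\<in>{1..<min i b}. 2 * (real b - real j) - 1)"
    using fin by (subst sum.Sigma[symmetric]) (auto intro!: sum.cong)
  finally show ?thesis .
qed

lemma sum_odd_pairs:
  assumes "1 \<le> m"
  shows "(\<Sum>j\<in>{1..<m}. 2 * (x - real j) - 1 + (2 * (y - real j) - 1)) =
    2 * (real m - 1) * (x + y - 1 - real m)"
  using assms
  by (induction m rule: dec_induct) (auto simp: algebra_simps)

text \<open>What the cell \<open>(a, b)\<close> collects from its row and from its column: with \<open>m = min a b\<close>, the
  factors \<open>m - 1\<close> and \<open>a + b - m - 1\<close> of the sum are \<open>a - 1\<close> and \<open>b - 1\<close> in some order.\<close>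

lemma sum_odd_pairs_min:
  assumes "1 \<le> a" "1 \<le> b"
  shows "(\<Sum>j\<in>{1..<min a b}. 2 * (real b - real j) - 1) +
      (\<Sum>j\<in>{1..<min a b}. 2 * (real a - real j) - 1) = 2 * real ((a - 1) * (b - 1))"
proof -
  have "(\<Sum>j\<in>{1..<min a b}. 2 * (real b - real j) - 1) +
      (\<Sum>j\<in>{1..<min a b}. 2 * (real a - real j) - 1) =
      2 * (real (min a b) - 1) * (real b + real a - 1 - real (min a b))"
    using assms by (subst sum.distrib[symmetric]) (rule sum_odd_pairs, simp)
  also have "\<dots> = 2 * ((real a - 1) * (real b - 1))"
    by (cases "a \<le> b") (simp_all add: min_def)
  finally show ?thesis
    using assms by (simp add: of_nat_diff)
qed

lemma sum_partial_hook_length: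
  assumes "partition_of n lam"
  shows "(\<Sum>u \<in> young lam. (real_of_int (partial_hook_length lam u))\<^sup>2) =
    2 * real (\<Sum>(a, b) \<in> young lam. (a - 1) * (b - 1))"
proof -
  let ?Y = "young lam"
  let ?h = "\<lambda>u. (real_of_int (partial_hook_length lam u))\<^sup>2"
  let ?L = "{(i, j) \<in> ?Y. j < i}" and ?U = "{(i, j) \<in> ?Y. i < j}"
  let ?c = "conjugate lam"
  note fin = finite_young[OF assms] and conj = young_conjugate[OF assms]
  have finc: "finite (young ?c)"
    using fin by (simp add: conj)
  have "sum ?h ?Y = sum ?h (?L \<union> ?U)"
    by (rule sum.mono_neutral_right[OF fin])
       (auto simp: partial_hook_length_def simp del: mem_young split: if_splits)
  also have "\<dots> = sum ?h ?L + sum ?h ?U"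
    by (rule sum.union_disjoint) (auto intro: finite_subset[OF _ fin] simp del: mem_young)
  also have "sum ?h ?L = (\<Sum>(i, j) \<in> ?L. (real (lam i) - real j)\<^sup>2)"
    by (intro sum.cong) (auto simp: partial_hook_length_def)
  also have "\<dots> = (\<Sum>(a, b) \<in> ?Y. \<Sum>j\<in>{1..<min a b}. 2 * (real b - real j) - 1)"
    by (rule sum_squares_below_diagonal[OF fin])
  also have "sum ?h ?U = (\<Sum>(i, j) \<in> {(i, j) \<in> young ?c. j < i}. (real (?c i) - real j)\<^sup>2)"
    by (rule sum.reindex_bij_witness[of _ prod.swap prod.swap])
       (auto simp: conj partial_hook_length_def simp del: mem_young)
  also have "\<dots> = (\<Sum>(a, b) \<in> young ?c. \<Sum>j\<in>{1..<min a b}. 2 * (real b - real j) - 1)"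
    by (rule sum_squares_below_diagonal[OF finc])
  also have "\<dots> = (\<Sum>(a, b) \<in> ?Y. \<Sum>j\<in>{1..<min a b}. 2 * (real a - real j) - 1)"
    by (rule sum.reindex_bij_witness[of _ prod.swap prod.swap])
       (auto simp: conj min.commute simp del: mem_young)
  also have "(\<Sum>(a, b) \<in> ?Y. \<Sum>j\<in>{1..<min a b}. 2 * (real b - real j) - 1) + \<dots> =
      (\<Sum>(a, b) \<in> ?Y. 2 * real ((a - 1) * (b - 1)))"
    unfolding sum.distrib[symmetric]
    by (intro sum.cong refl, clarify) (rule sum_odd_pairs_min, auto)
  also have "\<dots> = 2 * real (\<Sum>(a, b) \<in> ?Y. (a - 1) * (b - 1))"
    by (simp add: sum_distrib_left case_prod_unfold)
  finally show ?thesis .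
qed

section \<open>Counting rectangles\<close>

theorem mainTheorem5:
  fixes n :: nat and lam :: "nat \<Rightarrow> nat"
  assumes "n \<ge> 1" and "partition_of n lam"
  shows "real (card (rectangles lam)) =
           (\<Sum>u \<in> young lam. real (hook_length lam u)) +
           1 / 2 * (\<Sum>u \<in> young lam. (real_of_int (partial_hook_length lam u))\<^sup>2)
       \<and> real (card (thin_rectangles lam)) = (\<Sum>u \<in> young lam. real (hook_length lam u))
       \<and> real (card (thick_rectangles lam)) =
           1 / 2 * (\<Sum>u \<in> young lam. (real_of_int (partial_hook_length lam u))\<^sup>2)"
proof -
  note part = assms(2)
  have thin: "real (card (thin_rectangles lam)) = (\<Sum>u \<in> young lam. real (hook_length lam u))"
    unfolding card_thin_rectangles(2)[OF part] sum_hook_length[OF part, symmetric] by simp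
  have thick: "real (card (thick_rectangles lam)) =
      1 / 2 * (\<Sum>u \<in> young lam. (real_of_int (partial_hook_length lam u))\<^sup>2)"
    unfolding card_thick_rectangles[OF part] sum_partial_hook_length[OF part] by simp
  show ?thesis
    using thin thick card_thin_rectangles(1)[OF part] by simp
qed

end
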